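(* For each $k\in[1,n]$ let $S_k$ be a finite subset of $R$ satisfying Condition (D) in $R$, $\psi_k:S_k\to\mathbb{Z}^+$, and $E_k\subseteq S_k$. Let $L$ be a finite set, $(e_\lambda\mid\lambda\in L)\in\mathbb{N}^L$, and let $(H_\lambda\mid\lambda\in L)$ be such that each $H_\lambda$ is an $e_\lambda$-hyperplane of $R^n$. Let $(\rho_\lambda\mid\lambda\in L)\in\Omega^L$ with $\deg(\rho_\lambda)=e_\lambda$ and $H_\lambda=\{u\in R^n:\rho_\lambda(u_1,\dots,u_n)=0\}$ for each $\lambda$. Fix $t\in\mathbb{Z}^+$ and assume: (i) for every $a\in(\prod_iS_i)\setminus(\prod_iE_i)$, $$|\{\lambda\in L:a\in H_\lambda\}|\geqslant\max\Big\{\sum_{i=1}^n\beta_i:\beta\in\mathbb{N}^n,\ \sum_{i=1}^n\lfloor\beta_i/\psi_i(a_i)\rfloor\leqslant t-1\Big\}+1;$$ (ii) there exists $w\in\prod_iS_i$ with $\prod_{\lambda\in L}\rho_\lambda(w_1,\dots,w_n)\neq0$. Then for every $m\in[1,n]$, $$\sum_{\lambda\in L}e_\lambda\geqslant\deg\Big(\prod_{\lambda\in L}\rho_\lambda\Big)\geqslant(t-1)\sum_{u\in S_m\setminus E_m}\psi_m(u)+\sum_{k=1}^n\sum_{u\in S_k\setminus E_k}\psi_k(u).$$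
   Context: Let $R$ be a commutative ring with identity $1_R$, $n$ a positive integer, $[1,n]=\{1,\dots,n\}$, $\mathbb{N}=\{0,1,2,\dots\}$, $\Omega=R[x_1,\dots,x_n]$, $\deg$ total degree. For $r\in\mathbb{N}$, a subset $H\subseteq R^n$ is an $r$-hyperplane of $R^n$ if there is $h\in\Omega$ with $\deg(h)=r$ and $H=\{u\in R^n:h(u_1,\dots,u_n)=0\}$. A subset $X\subseteq R$ satisfies Condition (D) in $R$ if for all $a\neq b$ in $X$, $b-a$ is not a zero divisor of $R$. *)

theory Defs
  imports "HOL-Library.FuncSet" "HOL-Library.Poly_Mapping"
begin

text \<open>
  The index type \<open>'n\<close> (of class \<open>finite\<close>) plays the role of \<open>{1, ..., n}\<close>, with \<open>n = CARD('n)\<close>.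
  A point of \<open>R^n\<close> is a function \<open>'n \<Rightarrow> 'a\<close>. Monomials are exponent vectors \<open>'n \<Rightarrow>\<^sub>0 nat\<close> and
  multiplication of polynomials is the convolution product of \<^theory>\<open>HOL-Library.Poly_Mapping\<close>.
\<close>

type_synonym ('n, 'a) polynomial = "('n \<Rightarrow>\<^sub>0 nat) \<Rightarrow>\<^sub>0 'a"

definition poly_eval :: "('n::finite, 'a::comm_ring_1) polynomial \<Rightarrow> ('n \<Rightarrow> 'a) \<Rightarrow> 'a" where
  "poly_eval p u = (\<Sum>\<mu>\<in>Poly_Mapping.keys p.
     Poly_Mapping.lookup p \<mu> * (\<Prod>i\<in>UNIV. u i ^ Poly_Mapping.lookup \<mu> i))"

text \<open>Being a natural number, the total degree of the zero polynomial is \<open>0\<close> here. Where this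
  matters, nonzeroness is required separately.\<close>

definition total_degree :: "('n::finite, 'a::comm_ring_1) polynomial \<Rightarrow> nat" where
  "total_degree p = Max (insert 0 ((\<lambda>\<mu>. \<Sum>i\<in>UNIV. Poly_Mapping.lookup \<mu> i) ` Poly_Mapping.keys p))"

text \<open>The condition \<open>h \<noteq> 0\<close> reflects the usual convention that the zero polynomial does not have
  a degree in \<open>\<nat>\<close>; it keeps the whole space from being a \<open>0\<close>-hyperplane.\<close>

definition is_hyperplane :: "nat \<Rightarrow> ('n::finite \<Rightarrow> 'a::comm_ring_1) set \<Rightarrow> bool" where
  "is_hyperplane r H \<longleftrightarrow>
     (\<exists>h :: ('n, 'a) polynomial. h \<noteq> 0 \<and> total_degree h = r \<and> H = {u. poly_eval h u = 0})"

definition zero_divisor :: "'a::comm_ring_1 \<Rightarrow> bool" where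
  "zero_divisor x \<longleftrightarrow> (\<exists>y. y \<noteq> 0 \<and> x * y = 0)"

definition condition_D :: "'a::comm_ring_1 set \<Rightarrow> bool" where
  "condition_D X \<longleftrightarrow> (\<forall>a\<in>X. \<forall>b\<in>X. a \<noteq> b \<longrightarrow> \<not> zero_divisor (b - a))"

text \<open>The maximum over \<open>\<beta>\<close> that occurs in the covering hypothesis is taken over a finite nonempty
  set, so that \<^const>\<open>Max\<close> is meaningful.\<close>

lemma finite_nonempty_exponent_sums:
  fixes c :: "'n::finite \<Rightarrow> nat"
  assumes "\<And>i. c i > 0"
  shows "finite {(\<Sum>i\<in>UNIV. \<beta> i) |\<beta>. (\<Sum>i\<in>UNIV. \<beta> i div c i) \<le> s}" (is "finite ?A")
    and "{(\<Sum>i\<in>UNIV. \<beta> i) |\<beta>. (\<Sum>i\<in>UNIV. \<beta> i div c i) \<le> s} \<noteq> {}"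
proof -
  have "?A \<subseteq> {..(\<Sum>i\<in>UNIV. c i * Suc s)}"
  proof (rule subsetI, elim CollectE exE conjE, simp only: atMost_iff)
    fix \<beta> :: "'n \<Rightarrow> nat"
    assume *: "(\<Sum>i\<in>UNIV. \<beta> i div c i) \<le> s"
    have "\<beta> i \<le> c i * Suc s" for i
    proof -
      have "\<beta> i div c i \<le> (\<Sum>i\<in>UNIV. \<beta> i div c i)"
        by (rule member_le_sum) auto
      hence "c i * (\<beta> i div c i) \<le> c i * s"
        using * by (intro mult_left_mono) auto
      moreover have "\<beta> i < c i + c i * (\<beta> i div c i)"
        using assms[of i] by (rule dividend_less_times_div)
      ultimately show ?thesis
        by (simp only: mult_Suc_right)
    qed
    thus "sum \<beta> UNIV \<le> (\<Sum>i\<in>UNIV. c i * Suc s)"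
      by (rule sum_mono)
  qed
  thus "finite ?A"
    by (rule finite_subset) simp
  have "0 \<in> ?A"
    by (rule CollectI, rule exI[of _ "\<lambda>_. 0"]) simp
  thus "?A \<noteq> {}"
    by (rule ex_in_conv[THEN iffD1, OF exI])
qed

end

theory Submission
  imports Defs
begin

text \<open>
  Let \<open>P\<close> be the product of the \<open>\<rho>\<^sub>\<lambda>\<close> and \<open>P(w) \<noteq> 0\<close>; then \<open>w\<close> lies in the product of the \<open>E\<^sub>k\<close>.
  For each \<open>k\<close>, Hermite interpolation (possible up to a factor that is not a zero divisor, by
  Condition (D)) gives a linear functional on polynomials in \<open>x\<^sub>k\<close> that kills all degrees less than
  \<open>d\<^sub>k = \<Sum>u\<in>S\<^sub>k - E\<^sub>k. c\<^sub>k(u)\<close> and combines evaluation at \<open>w\<^sub>k\<close> with Taylor coefficients of order less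
  than \<open>c\<^sub>k(u)\<close> at the points \<open>u \<in> S\<^sub>k - E\<^sub>k\<close>, where \<open>c\<^sub>k = \<psi>\<^sub>k\<close> for \<open>k \<noteq> m\<close> and \<open>c\<^sub>m = t \<psi>\<^sub>m\<close>. Apply the
  tensor product of these functionals to \<open>P\<close>. By the covering hypothesis every mixed term involves
  a vanishing Taylor coefficient of \<open>P\<close>, so a multiple of \<open>P(w)\<close> by a non-zero-divisor remains. It is
  nonzero, hence \<open>deg P \<ge> \<Sum>k. d\<^sub>k\<close>.
\<close>

section \<open>Hermite interpolation functionals in one variable\<close>

lemma not_zero_divisor_iff:
  "\<not> zero_divisor x \<longleftrightarrow> (\<forall>y. x * y = 0 \<longrightarrow> y = 0)"
  by (auto simp: zero_divisor_def)

lemma not_zero_divisor_1: "\<not> zero_divisor 1"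
  by (simp add: not_zero_divisor_iff)

lemma not_zero_divisor_mult:
  "\<not> zero_divisor x \<Longrightarrow> \<not> zero_divisor y \<Longrightarrow> \<not> zero_divisor (x * y)"
  unfolding not_zero_divisor_iff mult.assoc by blast

lemma not_zero_divisor_prod:
  "(\<And>x. x \<in> A \<Longrightarrow> \<not> zero_divisor (f x)) \<Longrightarrow> \<not> zero_divisor (\<Prod>x\<in>A. f x)"
  by (induction A rule: infinite_finite_induct)
    (auto simp: not_zero_divisor_1 not_zero_divisor_mult)

text \<open>A linear functional on univariate polynomials is represented by its values on the powers
  \<open>x^M\<close>. Here \<open>hasse a b\<close> is the functional extracting the coefficient of \<open>(x - a)^b\<close>.\<close>

definition hasse :: "'a::comm_ring_1 \<Rightarrow> nat \<Rightarrow> nat \<Rightarrow> 'a" where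
  "hasse a b M = of_nat (M choose b) * a ^ (M - b)"

lemma hasse_0_right [simp]: "hasse a b 0 = (if b = 0 then 1 else 0)"
  by (cases b) (simp_all add: hasse_def)

lemma hasse_0 [simp]: "hasse a 0 M = a ^ M"
  by (simp add: hasse_def)

text \<open>Pascal's rule, read off from \<open>x = a + (x - a)\<close> in
  \<open>x * x^M\<close>.\<close>

lemma hasse_Suc_Suc: "hasse a (Suc b) (Suc M) = a * hasse a (Suc b) M + hasse a b M"
proof (cases "M \<le> b")
  case True
  then show ?thesis by (cases "M = b") (auto simp: hasse_def binomial_eq_0)
next
  case False
  then have "M - b = Suc (M - Suc b)" by simp
  then show ?thesis by (simp add: hasse_def algebra_simps)
qed

text \<open>Composition of a functional with the divided difference \<open>f \<mapsto> (f - f(u)) / (x - u)\<close>.\<close>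

primrec divdiff :: "'a::comm_ring_1 \<Rightarrow> (nat \<Rightarrow> 'a) \<Rightarrow> nat \<Rightarrow> 'a" where
  "divdiff u F 0 = 0"
| "divdiff u F (Suc M) = u * divdiff u F M + F M"

lemma divdiff_add: "divdiff u (\<lambda>M. F M + G M) M = divdiff u F M + divdiff u G M"
  by (induction M) (auto simp: algebra_simps)

lemma divdiff_mult: "divdiff u (\<lambda>M. r * F M) M = r * divdiff u F M"
  by (induction M) (auto simp: algebra_simps)

lemma divdiff_sum: "divdiff u (\<lambda>M. \<Sum>x\<in>X. F x M) M = (\<Sum>x\<in>X. divdiff u (F x) M)"
  by (induction M) (auto simp: sum.distrib sum_distrib_left)

text \<open>Divided differences lower the degree by one, so one further power of \<open>x\<close> is
  killed.\<close>

lemma divdiff_eq_0: "(\<And>j. j < d \<Longrightarrow> F j = 0) \<Longrightarrow> M < Suc d \<Longrightarrow> divdiff u F M = 0"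
  by (induction M) auto

text \<open>Division by \<open>x - u\<close> shifts the Taylor coefficients at \<open>u\<close> by
  one place; both sides obey the same recurrence in \<open>M\<close>.\<close>

lemma divdiff_hasse_same: "divdiff u (hasse u b) M = hasse u (Suc b) M"
  by (induction M) (auto simp: hasse_Suc_Suc)

lemma divdiff_power: "(a - u) * divdiff u (\<lambda>M. a ^ M) M = a ^ M - u ^ M"
proof (induction M)
  case (Suc M)
  have "(a - u) * divdiff u (\<lambda>M. a ^ M) (Suc M) =
      u * ((a - u) * divdiff u (\<lambda>M. a ^ M) M) + (a - u) * a ^ M"
    by (simp add: algebra_simps)
  also have "\<dots> = a ^ Suc M - u ^ Suc M"
    unfolding Suc.IH by (simp add: algebra_simps)
  finally show ?case .
qed auto

text \<open>Let \<open>q\<close> be the divided difference of \<open>f\<close> at \<open>u\<close>.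
  Write \<open>(x - u) q = f - f(u)\<close> with \<open>x - u = (a - u) + (x - a)\<close> and
  compare coefficients of \<open>(x - a)^(b + 1)\<close>; the constant \<open>f(u)\<close> does not
  contribute.\<close>

lemma divdiff_hasse_Suc:
  "(a - u) * divdiff u (hasse a (Suc b)) M = hasse a (Suc b) M - divdiff u (hasse a b) M"
proof (induction M)
  case (Suc M)
  have "(a - u) * divdiff u (hasse a (Suc b)) (Suc M) =
      u * ((a - u) * divdiff u (hasse a (Suc b)) M) + (a - u) * hasse a (Suc b) M"
    by (simp add: algebra_simps)
  also have "\<dots> = hasse a (Suc b) (Suc M) - divdiff u (hasse a b) (Suc M)"
    unfolding Suc.IH hasse_Suc_Suc by (simp add: algebra_simps)
  finally show ?case .
qed auto

text \<open>The module of functionals that use only Taylor coefficients of order below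
  \<open>c v\<close> at the points \<open>v\<close> of \<open>T\<close>.\<close>

definition hasse_span :: "'a::comm_ring_1 set \<Rightarrow> ('a \<Rightarrow> nat) \<Rightarrow> (nat \<Rightarrow> 'a) set" where
  "hasse_span T c = {F. \<exists>\<alpha>. \<forall>M. F M = (\<Sum>x\<in>Sigma T (\<lambda>v. {..<c v}). \<alpha> x * hasse (fst x) (snd x) M)}"

lemma hasse_spanI:
  "(\<And>M. F M = (\<Sum>x\<in>Sigma T (\<lambda>v. {..<c v}). \<alpha> x * hasse (fst x) (snd x) M)) \<Longrightarrow> F \<in> hasse_span T c"
  unfolding hasse_span_def by blast

lemma hasse_span_0: "(\<lambda>_. 0) \<in> hasse_span T c"
  by (rule hasse_spanI[where \<alpha> = "\<lambda>_. 0"]) simp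

lemma hasse_span_add:
  assumes "F \<in> hasse_span T c" "G \<in> hasse_span T c"
  shows "(\<lambda>M. F M + G M) \<in> hasse_span T c"
proof -
  let ?X = "Sigma T (\<lambda>v. {..<c v})"
  obtain \<alpha> \<beta> where "\<forall>M. F M = (\<Sum>x\<in>?X. \<alpha> x * hasse (fst x) (snd x) M)"
    and "\<forall>M. G M = (\<Sum>x\<in>?X. \<beta> x * hasse (fst x) (snd x) M)"
    using assms unfolding hasse_span_def by blast
  then show ?thesis
    by (intro hasse_spanI[where \<alpha> = "\<lambda>x. \<alpha> x + \<beta> x"]) (simp add: sum.distrib distrib_right)
qed

lemma hasse_span_mult:
  assumes "F \<in> hasse_span T c"
  shows "(\<lambda>M. r * F M) \<in> hasse_span T c"
proof -
  let ?X = "Sigma T (\<lambda>v. {..<c v})"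
  obtain \<alpha> where "\<forall>M. F M = (\<Sum>x\<in>?X. \<alpha> x * hasse (fst x) (snd x) M)"
    using assms unfolding hasse_span_def by blast
  then show ?thesis
    by (intro hasse_spanI[where \<alpha> = "\<lambda>x. r * \<alpha> x"]) (simp add: sum_distrib_left mult.assoc)
qed

lemma hasse_span_diff:
  "F \<in> hasse_span T c \<Longrightarrow> G \<in> hasse_span T c \<Longrightarrow> (\<lambda>M. F M - G M) \<in> hasse_span T c"
  using hasse_span_add[OF _ hasse_span_mult[of G T c "-1"], of F] by simp

lemma hasse_span_base:
  assumes "finite T" "v \<in> T" "b < c v"
  shows "hasse v b \<in> hasse_span T c"
proof (rule hasse_spanI)
  fix M
  let ?X = "Sigma T (\<lambda>v. {..<c v})"
  have "(\<Sum>x\<in>?X. (if x = (v, b) then 1 else 0) * hasse (fst x) (snd x) M) =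
      (\<Sum>x\<in>?X. if x = (v, b) then hasse v b M else 0)"
    by (intro sum.cong) auto
  also have "\<dots> = hasse v b M"
    using assms by (subst sum.delta) auto
  finally show "hasse v b M = (\<Sum>x\<in>?X. (if x = (v, b) then 1 else 0) * hasse (fst x) (snd x) M)"
    by (rule sym)
qed

text \<open>A divided difference at \<open>u\<close> costs one more order at \<open>u\<close> and
  none elsewhere, up to a denominator \<open>D\<close> built from differences of points of
  \<open>T\<close>.\<close>

lemma divdiff_hasse_in_span:
  assumes "finite T" "condition_D T" "u \<in> T" "v \<in> T" "b < (c(u := c u - 1)) v" "0 < c u"
  shows "\<exists>D. \<not> zero_divisor D \<and> (\<lambda>M. D * divdiff u (hasse v b) M) \<in> hasse_span T c"
proof (cases "v = u")
  case True
  with assms have "hasse u (Suc b) \<in> hasse_span T c"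
    by (intro hasse_span_base) auto
  then show ?thesis
    using True by (intro exI[of _ 1]) (simp add: not_zero_divisor_1 divdiff_hasse_same)
next
  case False
  then have nzd: "\<not> zero_divisor (v - u)"
    using assms unfolding condition_D_def by auto
  have "b < c v" using assms False by simp
  \<comment> \<open>Each use of the recurrence \<open>divdiff_hasse_Suc\<close> costs one factor
    \<open>v - u\<close>, as does the base case \<open>divdiff_power\<close>; hence the exponent
    \<open>Suc b\<close>.\<close>
  then have "(\<lambda>M. (v - u) ^ Suc b * divdiff u (hasse v b) M) \<in> hasse_span T c"
  proof (induction b)
    case 0
    have "(\<lambda>M. hasse v 0 M - hasse u 0 M) \<in> hasse_span T c"
      using 0 assms by (intro hasse_span_diff hasse_span_base) auto
    moreover have "hasse v 0 = (\<lambda>M. v ^ M)" by auto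
    ultimately show ?case by (simp add: divdiff_power)
  next
    case (Suc b)
    have "(\<lambda>M. (v - u) ^ Suc b * hasse v (Suc b) M - (v - u) ^ Suc b * divdiff u (hasse v b) M)
        \<in> hasse_span T c"
      using Suc assms by (intro hasse_span_diff hasse_span_mult hasse_span_base Suc.IH) auto
    moreover have "(v - u) ^ Suc (Suc b) * divdiff u (hasse v (Suc b)) M =
        (v - u) ^ Suc b * hasse v (Suc b) M - (v - u) ^ Suc b * divdiff u (hasse v b) M" for M
      using divdiff_hasse_Suc[of v u b M]
      by (simp only: power_Suc2[of "v - u" "Suc b"] mult.assoc flip: right_diff_distrib)
    ultimately show ?case by (simp only:)
  qed
  moreover have "\<not> zero_divisor ((v - u) ^ Suc b)"
    using not_zero_divisor_prod[of "{..<Suc b}" "\<lambda>_. v - u"] nzd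
    by (simp only: prod_constant card_lessThan not_False_eq_True)
  ultimately show ?thesis by (intro exI conjI)
qed

text \<open>Extends the previous lemma by linearity; the product of the finitely many denominators
  serves as a common one.\<close>

lemma divdiff_in_span:
  assumes "finite T" "condition_D T" "u \<in> T" "0 < c u" "F \<in> hasse_span T (c(u := c u - 1))"
  shows "\<exists>D. \<not> zero_divisor D \<and> (\<lambda>M. D * divdiff u F M) \<in> hasse_span T c"
proof -
  let ?X = "Sigma T (\<lambda>v. {..<(c(u := c u - 1)) v})"
  obtain \<alpha> where \<alpha>: "\<And>M. F M = (\<Sum>x\<in>?X. \<alpha> x * hasse (fst x) (snd x) M)"
    using assms(5) unfolding hasse_span_def by blast
  have "finite ?X" using assms by simp
  then have "\<exists>D. \<not> zero_divisor D \<and>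
      (\<lambda>M. D * (\<Sum>x\<in>?X. \<alpha> x * divdiff u (hasse (fst x) (snd x)) M)) \<in> hasse_span T c"
  proof (induction rule: finite_subset_induct[OF _ order.refl, consumes 1])
    case 1
    show ?case using hasse_span_0 by (intro exI[of _ 1]) (simp add: not_zero_divisor_1)
  next
    case (2 x Y)
    obtain D where D: "\<not> zero_divisor D" "(\<lambda>M. D * (\<Sum>x\<in>Y. \<alpha> x * divdiff u (hasse (fst x) (snd x)) M)) \<in> hasse_span T c"
      using 2(4) by (elim exE conjE) (rule that)
    obtain D' where D': "\<not> zero_divisor D'" "(\<lambda>M. D' * divdiff u (hasse (fst x) (snd x)) M) \<in> hasse_span T c"
    proof -
      have "fst x \<in> T" "snd x < (c(u := c u - 1)) (fst x)" using 2(2) by auto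
      from divdiff_hasse_in_span[OF assms(1-3) this assms(4)] show ?thesis
        by (elim exE conjE) (rule that)
    qed
    have "(\<lambda>M. (D * \<alpha> x) * (D' * divdiff u (hasse (fst x) (snd x)) M) +
        D' * (D * (\<Sum>x\<in>Y. \<alpha> x * divdiff u (hasse (fst x) (snd x)) M))) \<in> hasse_span T c"
      by (intro hasse_span_add hasse_span_mult D D')
    moreover have "(D * D') * (\<Sum>x\<in>insert x Y. \<alpha> x * divdiff u (hasse (fst x) (snd x)) M) =
        (D * \<alpha> x) * (D' * divdiff u (hasse (fst x) (snd x)) M) +
        D' * (D * (\<Sum>x\<in>Y. \<alpha> x * divdiff u (hasse (fst x) (snd x)) M))" for M
      using 2 by (simp add: algebra_simps)
    ultimately show ?case
      using D D' by (intro exI[of _ "D * D'"]) (simp add: not_zero_divisor_mult)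
  qed
  moreover have "divdiff u F M = (\<Sum>x\<in>?X. \<alpha> x * divdiff u (hasse (fst x) (snd x)) M)" for M
  proof -
    have "F = (\<lambda>M. \<Sum>x\<in>?X. \<alpha> x * hasse (fst x) (snd x) M)" using \<alpha> by auto
    then show ?thesis by (simp only: divdiff_sum divdiff_mult)
  qed
  ultimately show ?thesis by simp
qed

text \<open>Induction on the number of interpolation conditions. Take one order away at some
  \<open>u\<close> with \<open>0 < c u\<close>; composing the resulting functional with the divided
  difference at \<open>u\<close> kills one more power.\<close>

lemma hermite_functional:
  fixes c :: "'a::comm_ring_1 \<Rightarrow> nat"
  assumes "finite T" "condition_D (insert w T)" "w \<notin> T"
  shows "\<exists>\<delta> F. \<not> zero_divisor \<delta> \<and> F \<in> hasse_span T c \<and> (\<forall>M<\<Sum>v\<in>T. c v. \<delta> * w ^ M + F M = 0)"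
proof (induction "\<Sum>v\<in>T. c v" arbitrary: c)
  case 0
  show ?case
    unfolding 0[symmetric] using hasse_span_0[of T c] not_zero_divisor_1 by blast
next
  case (Suc d)
  have DT: "condition_D T" using assms unfolding condition_D_def by auto
  have "sum c T \<noteq> 0"
    using Suc.hyps(2) by simp
  then obtain u where u: "u \<in> T" "0 < c u"
    using assms(1) by auto
  let ?c = "c(u := c u - 1)"
  have nzd: "\<not> zero_divisor (w - u)"
    using assms u unfolding condition_D_def by auto
  have "(\<Sum>v\<in>T. c v) = c u + (\<Sum>v\<in>T - {u}. c v)"
    using assms(1) u by (simp add: sum.remove)
  moreover have "(\<Sum>v\<in>T. ?c v) = ?c u + (\<Sum>v\<in>T - {u}. c v)"
    using assms(1) u by (subst sum.remove[of _ u]) (auto intro!: sum.cong)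
  ultimately have d: "d = (\<Sum>v\<in>T. ?c v)"
    using Suc.hyps(2) u by simp
  obtain \<delta> F where \<delta>: "\<not> zero_divisor \<delta>" and F: "F \<in> hasse_span T ?c"
    and 0: "\<And>M. M < d \<Longrightarrow> \<delta> * w ^ M + F M = 0"
    using Suc.hyps(1)[OF d] unfolding d[symmetric] by blast
  obtain D where D: "\<not> zero_divisor D" "(\<lambda>M. D * divdiff u F M) \<in> hasse_span T c"
    using divdiff_in_span[OF assms(1) DT u F] by (elim exE conjE) (rule that)
  \<comment> \<open>Times \<open>w - u\<close>, the divided difference turns evaluation at
    \<open>w\<close> into \<open>f(w) - f(u)\<close>. The part \<open>f(u)\<close> moves into
    \<open>?F\<close>, where order 0 at \<open>u\<close> is available because
    \<open>0 < c u\<close>.\<close>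
  let ?F = "\<lambda>M. (w - u) * (D * divdiff u F M) - D * \<delta> * hasse u 0 M"
  have "?F \<in> hasse_span T c"
    using assms u by (intro hasse_span_diff hasse_span_mult D hasse_span_base) auto
  moreover have "\<not> zero_divisor (D * \<delta>)"
    using D \<delta> by (rule_tac not_zero_divisor_mult)
  moreover have "D * \<delta> * w ^ M + ?F M = 0" if "M < Suc d" for M
  proof -
    have "0 = (w - u) * D * divdiff u (\<lambda>M. \<delta> * w ^ M + F M) M"
      using divdiff_eq_0[OF 0 that] by simp
    also have "\<dots> = D * \<delta> * ((w - u) * divdiff u (\<lambda>M. w ^ M) M) + (w - u) * (D * divdiff u F M)"
      by (simp add: divdiff_add divdiff_mult algebra_simps)
    finally show ?thesis
      unfolding divdiff_power by (simp add: algebra_simps)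
  qed
  ultimately show ?case
    unfolding Suc.hyps(2)[symmetric] by (intro exI[of _ "D * \<delta>"] exI[of _ ?F]) simp
qed

section \<open>Tensor products of functionals\<close>

text \<open>The coefficient type is general so that the rule applies to exponent vectors as well as
  to polynomials.\<close>

lemma polynomial_induct [case_names zero single add]:
  fixes p :: "'k \<Rightarrow>\<^sub>0 'a::comm_monoid_add"
  assumes "P 0" "\<And>k c. P (Poly_Mapping.single k c)" "\<And>p q. P p \<Longrightarrow> P q \<Longrightarrow> P (p + q)"
  shows "P p"
proof (induction p rule: update_induct)
  case const
  show ?case by fact
next
  case (update f a b)
  then have "Poly_Mapping.update a b f = f + Poly_Mapping.single a b"
    by (intro poly_mapping_eqI) (auto simp: lookup_update lookup_add lookup_single in_keys_iff when_def)
  then show ?case using update assms by simp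
qed

text \<open>For \<open>\<phi> i M = u i ^ M\<close> this is \<open>poly_eval p u\<close>.\<close>

definition tensor :: "('n::finite \<Rightarrow> nat \<Rightarrow> 'a::comm_ring_1) \<Rightarrow> ('n, 'a) polynomial \<Rightarrow> 'a" where
  "tensor \<phi> p = (\<Sum>\<mu>\<in>Poly_Mapping.keys p.
     Poly_Mapping.lookup p \<mu> * (\<Prod>i\<in>UNIV. \<phi> i (Poly_Mapping.lookup \<mu> i)))"

lemma tensor_0 [simp]: "tensor \<phi> 0 = 0"
  by (simp add: tensor_def)

lemma tensor_add: "tensor \<phi> (p + q) = tensor \<phi> p + tensor \<phi> q"
  unfolding tensor_def by (rule setsum_keys_plus_distrib) (auto simp: algebra_simps)

lemma tensor_single:
  "tensor \<phi> (Poly_Mapping.single \<mu> c) = c * (\<Prod>i\<in>UNIV. \<phi> i (Poly_Mapping.lookup \<mu> i))"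
  by (simp add: tensor_def)

lemma tensor_monomial_mult:
  "tensor \<phi> (Poly_Mapping.single \<nu> c * p) =
    c * tensor (\<lambda>i M. \<phi> i (Poly_Mapping.lookup \<nu> i + M)) p"
  by (induction p rule: polynomial_induct)
    (auto simp: mult_single tensor_single tensor_add distrib_left lookup_add mult.assoc)

text \<open>Multilinearity in the single slot \<open>k\<close>; it lifts Pascal's rule to several
  variables.\<close>

lemma tensor_add_coordinate:
  fixes k :: "'n::finite"
  assumes "\<And>M. \<phi> k M = r * \<phi>1 k M + s * \<phi>2 k M"
    and "\<And>i. i \<noteq> k \<Longrightarrow> \<phi>1 i = \<phi> i" "\<And>i. i \<noteq> k \<Longrightarrow> \<phi>2 i = \<phi> i"
  shows "tensor \<phi> p = r * tensor \<phi>1 p + s * tensor \<phi>2 p"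
proof (induction p rule: polynomial_induct)
  case (single \<mu> c)
  have "(\<Prod>i\<in>UNIV - {k}. \<phi>1 i (Poly_Mapping.lookup \<mu> i)) = (\<Prod>i\<in>UNIV - {k}. \<phi> i (Poly_Mapping.lookup \<mu> i))"
    "(\<Prod>i\<in>UNIV - {k}. \<phi>2 i (Poly_Mapping.lookup \<mu> i)) = (\<Prod>i\<in>UNIV - {k}. \<phi> i (Poly_Mapping.lookup \<mu> i))"
    using assms by (auto intro!: prod.cong)
  then show ?case
    by (simp add: tensor_single prod.remove[of UNIV k] assms(1) algebra_simps)
qed (auto simp: tensor_add algebra_simps)

text \<open>Full multilinear expansion: \<open>g\<close> chooses one summand in each
  coordinate.\<close>

lemma tensor_expand:
  assumes "\<And>k. finite (X k)" "\<And>k M. \<phi> k M = (\<Sum>x\<in>X k. \<alpha> k x * f k x M)"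
  shows "tensor \<phi> p = (\<Sum>g\<in>PiE UNIV X. (\<Prod>k\<in>UNIV. \<alpha> k (g k)) * tensor (\<lambda>k. f k (g k)) p)"
  unfolding tensor_def assms(2) sum_distrib_left
  by (subst sum.swap, subst prod_sum_PiE)
    (auto simp: assms(1) sum_distrib_left prod.distrib algebra_simps intro!: sum.cong)

section \<open>Order of vanishing\<close>

text \<open>The coefficient of \<open>y^\<beta>\<close> in \<open>p(a + y)\<close>.\<close>

definition taylor_coeff ::
  "('n::finite \<Rightarrow> 'a::comm_ring_1) \<Rightarrow> ('n \<Rightarrow> nat) \<Rightarrow> ('n, 'a) polynomial \<Rightarrow> 'a" where
  "taylor_coeff a \<beta> = tensor (\<lambda>i. hasse (a i) (\<beta> i))"

definition vanishes :: "('n::finite \<Rightarrow> 'a::comm_ring_1) \<Rightarrow> nat \<Rightarrow> ('n, 'a) polynomial \<Rightarrow> bool" where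
  "vanishes a s p \<longleftrightarrow> (\<forall>\<beta>. sum \<beta> UNIV < s \<longrightarrow> taylor_coeff a \<beta> p = 0)"

lemma taylor_coeff_0: "taylor_coeff a (\<lambda>_. 0) p = poly_eval p a"
  by (simp add: taylor_coeff_def tensor_def poly_eval_def)

text \<open>In \<open>(a k + y k) p(a + y)\<close> the summand with \<open>y k\<close> involves only
  a coefficient of \<open>p\<close> of total order below \<open>s\<close>, which vanishes.\<close>

lemma taylor_coeff_variable_mult:
  fixes a :: "'n::finite \<Rightarrow> 'a::comm_ring_1"
  assumes "vanishes a s p" "sum \<beta> UNIV \<le> s"
  shows "taylor_coeff a \<beta> (Poly_Mapping.single (Poly_Mapping.single k 1) 1 * p) =
    a k * taylor_coeff a \<beta> p"
proof -
  \<comment> \<open>For \<open>\<beta> k = 0\<close> the subtraction truncates, and the factor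
    \<open>?r\<close> removes the spurious term.\<close>
  let ?\<beta> = "\<beta>(k := \<beta> k - 1)"
  let ?r = "if \<beta> k = 0 then 0 else 1 :: 'a"
  have "taylor_coeff a \<beta> (Poly_Mapping.single (Poly_Mapping.single k 1) 1 * p) =
      a k * taylor_coeff a \<beta> p + ?r * taylor_coeff a ?\<beta> p"
    unfolding taylor_coeff_def tensor_monomial_mult mult_1_left
  proof (rule tensor_add_coordinate[where k = k])
    fix M
    show "hasse (a k) (\<beta> k) (Poly_Mapping.lookup (Poly_Mapping.single k 1) k + M) =
        a k * hasse (a k) (\<beta> k) M + ?r * hasse (a k) (?\<beta> k) M"
      by (cases "\<beta> k") (auto simp: hasse_Suc_Suc)
  qed (auto simp: lookup_single)
  moreover have "?r * taylor_coeff a ?\<beta> p = 0"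
  proof (cases "\<beta> k = 0")
    case False
    then have "sum ?\<beta> UNIV < sum \<beta> UNIV"
      by (intro sum_strict_mono_ex1) auto
    then show ?thesis using assms unfolding vanishes_def by simp
  qed auto
  ultimately show ?thesis by simp
qed

text \<open>In the polynomial \<open>f(a + y) g(a + y)\<close> the part of degree at most the order of \<open>g\<close> at \<open>a\<close>
  only depends on the constant term of \<open>f(a + y)\<close>.\<close>

definition leading_law :: "('n::finite \<Rightarrow> 'a::comm_ring_1) \<Rightarrow> ('n, 'a) polynomial \<Rightarrow> 'a \<Rightarrow> bool" where
  "leading_law a f r \<longleftrightarrow> (\<forall>g s \<beta>. vanishes a s g \<longrightarrow> sum \<beta> UNIV \<le> s \<longrightarrow>
     taylor_coeff a \<beta> (f * g) = r * taylor_coeff a \<beta> g)"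

lemma leading_law_vanishes: "leading_law a f r \<Longrightarrow> vanishes a s g \<Longrightarrow> vanishes a s (f * g)"
  unfolding leading_law_def vanishes_def by (metis less_imp_le mult_zero_right)

lemma leading_law_mult:
  assumes "leading_law a f r" "leading_law a g r'"
  shows "leading_law a (f * g) (r * r')"
  unfolding leading_law_def
proof (intro allI impI)
  fix h s and \<beta> :: "'a \<Rightarrow> nat"
  assume h: "vanishes a s h" and \<beta>: "sum \<beta> UNIV \<le> s"
  have "taylor_coeff a \<beta> (f * (g * h)) = r * taylor_coeff a \<beta> (g * h)"
    using assms(1) leading_law_vanishes[OF assms(2) h] \<beta> unfolding leading_law_def by blast
  also have "taylor_coeff a \<beta> (g * h) = r' * taylor_coeff a \<beta> h"
    using assms(2) h \<beta> unfolding leading_law_def by blast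
  finally show "taylor_coeff a \<beta> (f * g * h) = r * r' * taylor_coeff a \<beta> h"
    by (simp add: mult.assoc)
qed

lemma leading_law_add:
  "leading_law a f r \<Longrightarrow> leading_law a g r' \<Longrightarrow> leading_law a (f + g) (r + r')"
  unfolding leading_law_def by (simp add: taylor_coeff_def tensor_add distrib_right)

lemma leading_law_const: "leading_law a (Poly_Mapping.single 0 c) c"
  unfolding leading_law_def by (simp add: taylor_coeff_def tensor_monomial_mult)

lemma leading_law_variable: "leading_law a (Poly_Mapping.single (Poly_Mapping.single k 1) 1) (a k)"
  unfolding leading_law_def using taylor_coeff_variable_mult by blast

text \<open>Existence of some \<open>r\<close> suffices here; its value is identified once for all
  polynomials in \<open>leading_law\<close>.\<close>

lemma leading_law_monomial:
  fixes a :: "'n::finite \<Rightarrow> 'a::comm_ring_1"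
  shows "\<exists>r. leading_law a (Poly_Mapping.single \<mu> 1) r"
proof (induction \<mu> rule: polynomial_induct)
  case zero
  show ?case using leading_law_const by blast
next
  case (single k m)
  show ?case
  proof (induction m)
    case 0
    show ?case using leading_law_const[of a 1] by auto
  next
    case (Suc m)
    have "Poly_Mapping.single (Poly_Mapping.single k (Suc m)) (1 :: 'a) =
        Poly_Mapping.single (Poly_Mapping.single k 1) 1 * Poly_Mapping.single (Poly_Mapping.single k m) 1"
      by (simp add: mult_single flip: single_add)
    then show ?case
      using Suc leading_law_mult[OF leading_law_variable] by metis
  qed
next
  case (add \<mu> \<nu>)
  have "Poly_Mapping.single (\<mu> + \<nu>) (1 :: 'a) = Poly_Mapping.single \<mu> 1 * Poly_Mapping.single \<nu> 1"
    by (simp add: mult_single)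
  then show ?case
    using add leading_law_mult by metis
qed

text \<open>Constants and monomials generate all polynomials, so some \<open>r\<close> exists;
  testing it on \<open>g = 1\<close> at order 0 shows that it is the value at
  \<open>a\<close>.\<close>

lemma leading_law: "leading_law a f (poly_eval f a)"
proof -
  have "\<exists>r. leading_law a f r"
  proof (induction f rule: polynomial_induct)
    case zero
    show ?case using leading_law_const[of a 0] by auto
  next
    case (single \<mu> c)
    have "Poly_Mapping.single \<mu> c = Poly_Mapping.single 0 c * Poly_Mapping.single \<mu> 1"
      by (simp add: mult_single)
    then show ?case
      using leading_law_monomial leading_law_mult leading_law_const by metis
  next
    case (add p q)
    then show ?case using leading_law_add by blast
  qed
  then obtain r where r: "leading_law a f r" by blast
  have "taylor_coeff a (\<lambda>_. 0) 1 = 1"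
    by (simp add: taylor_coeff_def tensor_single flip: single_one)
  moreover have "taylor_coeff a (\<lambda>_. 0) (f * 1) = r * taylor_coeff a (\<lambda>_. 0) 1"
    using r[unfolded leading_law_def, rule_format, of 0 1 "\<lambda>_. 0"] by (simp add: vanishes_def)
  ultimately show ?thesis
    using r by (simp add: taylor_coeff_0)
qed

text \<open>A factor with value 0 at \<open>a\<close> also kills the lowest-order part, raising the
  order by one; by \<open>leading_law_vanishes\<close> any other factor preserves the order.\<close>

lemma vanishes_prod:
  assumes "finite L"
  shows "vanishes a (card {l \<in> L. poly_eval (f l) a = 0}) (\<Prod>l\<in>L. f l)"
  using assms
proof (induction rule: finite_induct)
  case empty
  show ?case by (simp add: vanishes_def)
next
  case (insert x L)
  let ?s = "card {l \<in> L. poly_eval (f l) a = 0}"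
  have eq: "{l \<in> insert x L. poly_eval (f l) a = 0} =
      (if poly_eval (f x) a = 0 then insert x {l \<in> L. poly_eval (f l) a = 0}
       else {l \<in> L. poly_eval (f l) a = 0})"
    by auto
  show ?case
  proof (cases "poly_eval (f x) a = 0")
    case True
    have "vanishes a (Suc ?s) (f x * (\<Prod>l\<in>L. f l))"
      using leading_law[of a "f x"] insert.IH True
      unfolding vanishes_def[of a "Suc ?s"] leading_law_def by (simp add: less_Suc_eq_le)
    then show ?thesis
      unfolding eq using insert.hyps True by simp
  next
    case False
    then show ?thesis
      using leading_law_vanishes[OF leading_law insert.IH] insert.hyps unfolding eq by simp
  qed
qed

section \<open>The degree bound\<close>

lemma total_degree_le_iff:
  "total_degree p \<le> d \<longleftrightarrow>
    (\<forall>\<mu>\<in>Poly_Mapping.keys p. (\<Sum>i\<in>UNIV. Poly_Mapping.lookup \<mu> i) \<le> d)"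
  by (auto simp: total_degree_def)

text \<open>Equality can fail, since leading coefficients may be zero divisors.\<close>

lemma total_degree_mult_le: "total_degree (p * q) \<le> total_degree p + total_degree q"
  unfolding total_degree_le_iff
proof
  fix \<mu> assume "\<mu> \<in> Poly_Mapping.keys (p * q)"
  then obtain \<nu> \<kappa> where "\<mu> = \<nu> + \<kappa>" "\<nu> \<in> Poly_Mapping.keys p" "\<kappa> \<in> Poly_Mapping.keys q"
    using keys_mult by blast
  moreover from this have "(\<Sum>i\<in>UNIV. Poly_Mapping.lookup \<nu> i) \<le> total_degree p"
    "(\<Sum>i\<in>UNIV. Poly_Mapping.lookup \<kappa> i) \<le> total_degree q"
    using total_degree_le_iff by blast+
  ultimately show "(\<Sum>i\<in>UNIV. Poly_Mapping.lookup \<mu> i) \<le> total_degree p + total_degree q"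
    by (simp add: lookup_add sum.distrib)
qed

lemma total_degree_prod_le: "total_degree (\<Prod>l\<in>L. f l) \<le> (\<Sum>l\<in>L. total_degree (f l))"
proof (induction L rule: infinite_finite_induct)
  case (insert x L)
  then show ?case using total_degree_mult_le[of "f x" "\<Prod>l\<in>L. f l"] by simp
qed (simp_all add: total_degree_def)

text \<open>Pigeonhole: each monomial of \<open>p\<close> has some exponent below
  \<open>N k\<close>, which makes one factor zero.\<close>

lemma tensor_eq_0_if_degree_less:
  fixes p :: "('n::finite, 'a::comm_ring_1) polynomial"
  assumes "\<And>k M. M < N k \<Longrightarrow> \<phi> k M = 0" "total_degree p < (\<Sum>k\<in>UNIV. N k)"
  shows "tensor \<phi> p = 0"
  unfolding tensor_def
proof (rule sum.neutral, rule ballI)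
  fix \<mu> assume "\<mu> \<in> Poly_Mapping.keys p"
  then have "(\<Sum>i\<in>UNIV. Poly_Mapping.lookup \<mu> i) < (\<Sum>k\<in>UNIV. N k)"
    using assms(2) total_degree_le_iff[of p "total_degree p"] by fastforce
  then obtain k where "Poly_Mapping.lookup \<mu> k < N k"
    by (metis not_less sum_mono)
  then have "(\<Prod>i\<in>UNIV. \<phi> i (Poly_Mapping.lookup \<mu> i)) = 0"
    using assms(1) by (intro prod_zero) auto
  then show "Poly_Mapping.lookup p \<mu> * (\<Prod>i\<in>UNIV. \<phi> i (Poly_Mapping.lookup \<mu> i)) = 0" by simp
qed

text \<open>A Nullstellensatz with multiplicities. If the degree were smaller, the tensor product of
  the Hermite functionals would kill \<open>p\<close>, while its expansion leaves only a multiple of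
  \<open>p(w)\<close> by a non-zero-divisor.\<close>

lemma total_degree_ge_of_vanishing:
  fixes p :: "('n::finite, 'a::comm_ring_1) polynomial"
    and T :: "'n \<Rightarrow> 'a set" and c :: "'n \<Rightarrow> 'a \<Rightarrow> nat"
  assumes fin: "\<And>k. finite (T k)"
    and D: "\<And>k. condition_D (insert (w k) (T k))"
    and w: "\<And>k. w k \<notin> T k"
    and van: "\<And>a \<beta>. a \<noteq> w \<Longrightarrow> (\<And>k. a k = w k \<and> \<beta> k = 0 \<or> a k \<in> T k \<and> \<beta> k < c k (a k)) \<Longrightarrow>
       taylor_coeff a \<beta> p = 0"
    and nz: "poly_eval p w \<noteq> 0"
  shows "total_degree p \<ge> (\<Sum>k\<in>UNIV. \<Sum>u\<in>T k. c k u)"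
proof (rule ccontr)
  assume less: "\<not> ?thesis"
  have "\<exists>\<delta> F. \<not> zero_divisor \<delta> \<and> F \<in> hasse_span (T k) (c k) \<and>
      (\<forall>M<\<Sum>v\<in>T k. c k v. \<delta> * w k ^ M + F M = 0)" for k
    using fin D w by (rule hermite_functional)
  then obtain \<delta> F where \<delta>: "\<And>k. \<not> zero_divisor (\<delta> k)"
    and F: "\<And>k. F k \<in> hasse_span (T k) (c k)"
    and 0: "\<And>k M. M < (\<Sum>v\<in>T k. c k v) \<Longrightarrow> \<delta> k * w k ^ M + F k M = 0"
    by metis
  define Y where "Y k = Sigma (T k) (\<lambda>v. {..<c k v})" for k
  have "\<exists>\<alpha>. \<forall>M. F k M = (\<Sum>x\<in>Y k. \<alpha> x * hasse (fst x) (snd x) M)" for k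
    using F[of k] unfolding hasse_span_def Y_def by simp
  then obtain \<alpha> where \<alpha>: "\<And>k M. F k M = (\<Sum>x\<in>Y k. \<alpha> k x * hasse (fst x) (snd x) M)"
    by metis
  \<comment> \<open>The index \<open>(w k, 0)\<close> stands for evaluation at \<open>w k\<close>,
    with coefficient \<open>\<delta> k\<close>.\<close>
  define X where "X k = insert (w k, 0) (Y k)" for k
  define \<gamma> where "\<gamma> k = (\<alpha> k)((w k, 0) := \<delta> k)" for k
  have finX: "finite (X k)" for k using fin by (simp add: X_def Y_def)
  have notin: "(w k, 0) \<notin> Y k" for k using w by (simp add: Y_def)
  define V where "V k M = \<delta> k * w k ^ M + F k M" for k M
  have V: "V k M = (\<Sum>x\<in>X k. \<gamma> k x * hasse (fst x) (snd x) M)" for k M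
  proof -
    have "(\<Sum>x\<in>Y k. \<gamma> k x * hasse (fst x) (snd x) M) = F k M"
      using notin[of k] unfolding \<alpha> \<gamma>_def by (intro sum.cong) auto
    then show ?thesis
      using notin[of k] fin[of k] by (simp add: X_def V_def Y_def \<gamma>_def)
  qed
  let ?g = "\<lambda>k. (w k, 0 :: nat)"
  have other: "tensor (\<lambda>k. hasse (fst (g k)) (snd (g k))) p = 0"
    if gX: "g \<in> PiE UNIV X" and "g \<noteq> ?g" for g
  proof -
    have g: "g k = (w k, 0) \<or> fst (g k) \<in> T k \<and> snd (g k) < c k (fst (g k))" for k
      using PiE_mem[OF gX, of k] by (auto simp: X_def Y_def)
    obtain k where "g k \<noteq> (w k, 0)" using \<open>g \<noteq> ?g\<close> by auto
    \<comment> \<open>Any other index lies over a point of \<open>T k\<close>, so the base point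
      really changes.\<close>
    then have "fst (g k) \<noteq> w k" using g[of k] w[of k] by auto
    then have "(\<lambda>k. fst (g k)) \<noteq> w" by metis
    moreover have "fst (g k) = w k \<and> snd (g k) = 0 \<or> fst (g k) \<in> T k \<and> snd (g k) < c k (fst (g k))" for k
      using g[of k] by auto
    ultimately have "taylor_coeff (\<lambda>k. fst (g k)) (\<lambda>k. snd (g k)) p = 0"
      by (rule van)
    then show ?thesis by (simp add: taylor_coeff_def)
  qed
  have "0 = tensor V p"
    using tensor_eq_0_if_degree_less[of "\<lambda>k. \<Sum>v\<in>T k. c k v" V p] 0 less by (simp add: V_def)
  also have "\<dots> = (\<Sum>g\<in>PiE UNIV X. (\<Prod>k\<in>UNIV. \<gamma> k (g k)) * tensor (\<lambda>k. hasse (fst (g k)) (snd (g k))) p)"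
    using finX V by (rule tensor_expand)
  also have "\<dots> = (\<Sum>g\<in>{?g}. (\<Prod>k\<in>UNIV. \<gamma> k (g k)) * tensor (\<lambda>k. hasse (fst (g k)) (snd (g k))) p)"
    using finX other by (intro sum.mono_neutral_right finite_PiE) (auto simp: X_def)
  also have "\<dots> = (\<Prod>k\<in>UNIV. \<delta> k) * poly_eval p w"
    by (simp add: \<gamma>_def flip: taylor_coeff_0 taylor_coeff_def)
  finally have "poly_eval p w = 0"
    using not_zero_divisor_prod[of UNIV \<delta>] \<delta> unfolding not_zero_divisor_iff by metis
  with nz show False by simp
qed

theorem theorem6p1:
  fixes S E :: "'n::finite \<Rightarrow> 'a::comm_ring_1 set"
    and \<psi> :: "'n \<Rightarrow> 'a \<Rightarrow> nat"
    and L :: "'l set"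
    and e :: "'l \<Rightarrow> nat"
    and H :: "'l \<Rightarrow> ('n \<Rightarrow> 'a) set"
    and \<rho> :: "'l \<Rightarrow> ('n, 'a) polynomial"
    and t :: nat
    and m :: 'n
  assumes "\<And>k. finite (S k)"
    and "\<And>k. condition_D (S k)"
    and "\<And>k u. u \<in> S k \<Longrightarrow> \<psi> k u > 0"
    and "\<And>k. E k \<subseteq> S k"
    and "finite L"
    and "\<And>l. l \<in> L \<Longrightarrow> is_hyperplane (e l) (H l)"
    and "\<And>l. l \<in> L \<Longrightarrow> total_degree (\<rho> l) = e l"
    and "\<And>l. l \<in> L \<Longrightarrow> H l = {u. poly_eval (\<rho> l) u = 0}"
    and "t > 0"
    and "\<And>a. a \<in> Pi UNIV S - Pi UNIV E \<Longrightarrow>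
           card {l \<in> L. a \<in> H l} \<ge>
             Max {(\<Sum>i\<in>UNIV. \<beta> i) |\<beta>. (\<Sum>i\<in>UNIV. \<beta> i div \<psi> i (a i)) \<le> t - 1} + 1"
    and "\<exists>w \<in> Pi UNIV S. poly_eval (\<Prod>l\<in>L. \<rho> l) w \<noteq> 0"
  shows "(\<Sum>l\<in>L. e l) \<ge> total_degree (\<Prod>l\<in>L. \<rho> l) \<and>
         total_degree (\<Prod>l\<in>L. \<rho> l) \<ge>
           (t - 1) * (\<Sum>u\<in>S m - E m. \<psi> m u) + (\<Sum>k\<in>UNIV. \<Sum>u\<in>S k - E k. \<psi> k u)"
proof
  let ?P = "\<Prod>l\<in>L. \<rho> l"
  show "total_degree ?P \<le> (\<Sum>l\<in>L. e l)"
    using total_degree_prod_le[of \<rho> L] assms(7) by simp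
  obtain w where w: "w \<in> Pi UNIV S" "poly_eval ?P w \<noteq> 0"
    using assms(11) by blast
  have van: "taylor_coeff a \<beta> ?P = 0"
    if a: "a \<in> Pi UNIV S - Pi UNIV E" and \<beta>: "(\<Sum>i\<in>UNIV. \<beta> i div \<psi> i (a i)) \<le> t - 1" for a \<beta>
  proof -
    let ?B = "{(\<Sum>i\<in>UNIV. \<beta> i) |\<beta>. (\<Sum>i\<in>UNIV. \<beta> i div \<psi> i (a i)) \<le> t - 1}"
    have "0 < \<psi> i (a i)" for i using a by (intro assms(3)) auto
    then have "finite ?B" by (rule finite_nonempty_exponent_sums)
    then have "sum \<beta> UNIV \<le> Max ?B" using \<beta> by (intro Max_ge) auto
    \<comment> \<open>The \<open>+ 1\<close> of the covering hypothesis gives strictness: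
      \<open>?P\<close> vanishes at \<open>a\<close> to an order above the total of
      \<open>\<beta>\<close>.\<close>
    also have "\<dots> < card {l \<in> L. a \<in> H l}" using assms(10)[OF a] by simp
    also have "{l \<in> L. a \<in> H l} = {l \<in> L. poly_eval (\<rho> l) a = 0}" using assms(8) by auto
    finally show ?thesis
      using vanishes_prod[OF assms(5), of a \<rho>] unfolding vanishes_def by blast
  qed
  \<comment> \<open>Otherwise \<open>van\<close> with \<open>\<beta> = 0\<close> would give the
    value 0 at \<open>w\<close>.\<close>
  have wE: "w k \<in> E k" for k
    using van[of w "\<lambda>_. 0"] w by (auto simp: taylor_coeff_0)
  \<comment> \<open>Orders below \<open>c\<close> give quotient at most \<open>t - 1\<close> in
    coordinate \<open>m\<close> and 0 in the others, which just meets the bound in the covering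
    hypothesis.\<close>
  define c where "c k u = (if k = m then t else 1) * \<psi> k u" for k u
  have "(\<Sum>k\<in>UNIV. \<Sum>u\<in>S k - E k. c k u) \<le> total_degree ?P"
  proof (rule total_degree_ge_of_vanishing)
    show "condition_D (insert (w k) (S k - E k))" for k
      using assms(2)[of k] w(1) unfolding condition_D_def by auto
    fix a \<beta>
    assume aw: "a \<noteq> w"
      and a: "\<And>k. a k = w k \<and> \<beta> k = 0 \<or> a k \<in> S k - E k \<and> \<beta> k < c k (a k)"
    have "a k \<in> S k" for k using a[of k] w(1) by auto
    moreover obtain k where "a k \<noteq> w k" using aw by auto
    then have "a k \<notin> E k" using a[of k] by auto
    ultimately have "a \<in> Pi UNIV S - Pi UNIV E" by auto
    moreover have "(\<Sum>i\<in>UNIV. \<beta> i div \<psi> i (a i)) \<le> t - 1"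
    proof -
      have "\<beta> i div \<psi> i (a i) \<le> (if i = m then t - 1 else 0)" for i
      proof -
        have "\<beta> i div \<psi> i (a i) < t" if "\<beta> i < t * \<psi> i (a i)"
          using that by (rule less_mult_imp_div_less)
        then show ?thesis using a[of i] assms(9) by (auto simp: c_def split: if_splits)
      qed
      then have "(\<Sum>i\<in>UNIV. \<beta> i div \<psi> i (a i)) \<le> (\<Sum>i\<in>UNIV. if i = m then t - 1 else 0)"
        by (rule sum_mono)
      then show ?thesis by simp
    qed
    ultimately show "taylor_coeff a \<beta> ?P = 0" by (rule van)
  qed (use assms(1) wE w in auto)
  moreover have "(\<Sum>k\<in>UNIV. \<Sum>u\<in>S k - E k. c k u) =
      (t - 1) * (\<Sum>u\<in>S m - E m. \<psi> m u) + (\<Sum>k\<in>UNIV. \<Sum>u\<in>S k - E k. \<psi> k u)"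
  proof -
    obtain s where t: "t = Suc s" using assms(9) by (cases t) auto
    have "c k u = (if k = m then (t - 1) * \<psi> k u else 0) + \<psi> k u" for k u
      by (simp add: c_def t)
    then have "(\<Sum>u\<in>S k - E k. c k u) =
        (if k = m then (t - 1) * (\<Sum>u\<in>S m - E m. \<psi> m u) else 0) + (\<Sum>u\<in>S k - E k. \<psi> k u)" for k
      by (simp add: sum.distrib sum_distrib_left)
    then show ?thesis by (simp add: sum.distrib)
  qed
  ultimately show "(t - 1) * (\<Sum>u\<in>S m - E m. \<psi> m u) + (\<Sum>k\<in>UNIV. \<Sum>u\<in>S k - E k. \<psi> k u)
      \<le> total_degree ?P" by simp
qed

end
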